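(* Let $A$ be a primitive complex unital Banach algebra with nonzero socle $J=\mathrm{soc}(A)$, and let $p$ be a minimal idempotent of $A$. If $a\in A$ is a B-Fredholm element of $A$ modulo $J$, then the operator $\widehat{a}:Ap\to Ap$, $\widehat{a}(y)=ay$, is a B-Fredholm operator on the Banach space $Ap$.
   Context: An algebra is primitive if $\{0\}$ is a primitive ideal of it. A minimal idempotent of $A$ is a nonzero idempotent $p$ with $pAp=\mathbb{C}p$. Let $\pi:A\to A/J$ be the canonical projection, where $J=\mathrm{soc}(A)$ is the socle of $A$. An element $x$ of a unital ring $R$ is Drazin invertible in $R$ if there exist $y\in R$ and $k\in\mathbb{N}$ such that $yxy=y$, $xy=yx$ and $x^k y x=x^k$. An element $a\in A$ is a B-Fredholm element of $A$ modulo $J$ if $\pi(a)$ is Drazin invertible in $A/J$. A bounded linear operator $T$ on a Banach space $X$ is a B-Fredholm operator if there is an integer $n\ge 0$ such that the range $R(T^n)$ is closed and the restriction $T_n:R(T^n)\to R(T^n)$ of $T$ is a Fredholm operator. *)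

theory Defs
  imports "HOL-Analysis.Analysis" "HOL-Algebra.QuotRing" "HOL-Algebra.Algebraic_Closure_Type"
begin

section \<open>Complex Banach algebras\<close>

class complex_vector = real_vector +
  fixes scaleC :: "complex \<Rightarrow> 'a \<Rightarrow> 'a"  (infixr \<open>*\<^sub>C\<close> 75)
  assumes scaleC_add_right: "c *\<^sub>C (x + y) = c *\<^sub>C x + c *\<^sub>C y"
    and scaleC_add_left: "(c + d) *\<^sub>C x = c *\<^sub>C x + d *\<^sub>C x"
    and scaleC_scaleC: "c *\<^sub>C (d *\<^sub>C x) = (c * d) *\<^sub>C x"
    and scaleC_of_real: "complex_of_real r *\<^sub>C x = r *\<^sub>R x"

class complex_normed_vector = complex_vector + real_normed_vector +
  assumes norm_scaleC: "norm (c *\<^sub>C x) = cmod c * norm x"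

class complex_normed_algebra_1 = complex_normed_vector + real_normed_algebra_1 +
  assumes mult_scaleC_left: "(c *\<^sub>C x) * y = c *\<^sub>C (x * y)"
    and mult_scaleC_right: "x * (c *\<^sub>C y) = c *\<^sub>C (x * y)"

class complex_banach_algebra_1 = complex_normed_algebra_1 + banach

global_interpretation complex_vector: vector_space "scaleC :: complex \<Rightarrow> 'a \<Rightarrow> 'a::complex_vector"
proof
  show "1 *\<^sub>C x = x" for x :: 'a
    using scaleC_of_real[of 1 x] by simp
qed (simp_all add: scaleC_add_right scaleC_add_left scaleC_scaleC)


section \<open>Left ideals, primitive ideals and the socle\<close>

text \<open>Closure under negation follows from the last clause. In a unital complex algebra a left
  ideal of the ring is automatically a complex subspace, as \<open>c *\<^sub>C x = (c *\<^sub>C 1) * x\<close>, so ring ideals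
  and algebra ideals agree.\<close>

definition left_ideal :: "'a::ring_1 set \<Rightarrow> bool" where
  "left_ideal L \<longleftrightarrow> 0 \<in> L \<and> (\<forall>x\<in>L. \<forall>y\<in>L. x + y \<in> L) \<and> (\<forall>r. \<forall>x\<in>L. r * x \<in> L)"

definition maximal_left_ideal :: "'a::ring_1 set \<Rightarrow> bool" where
  "maximal_left_ideal L \<longleftrightarrow> left_ideal L \<and> L \<noteq> UNIV \<and>
     (\<forall>M. left_ideal M \<and> L \<subseteq> M \<longrightarrow> M = L \<or> M = UNIV)"

text \<open>A primitive ideal is the quotient \<open>L : A = {a. a A \<subseteq> L}\<close> of a maximal modular left ideal
  \<open>L\<close>, i.e. the kernel of the irreducible representation of \<open>A\<close> on \<open>A / L\<close>. Every left ideal is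
  modular here because of the unit.\<close>

definition primitive_ideal :: "'a::ring_1 set \<Rightarrow> bool" where
  "primitive_ideal P \<longleftrightarrow> (\<exists>L. maximal_left_ideal L \<and> P = {a. \<forall>x. a * x \<in> L})"

definition minimal_left_ideal :: "'a::ring_1 set \<Rightarrow> bool" where
  "minimal_left_ideal M \<longleftrightarrow> left_ideal M \<and> M \<noteq> {0} \<and>
     (\<forall>N. left_ideal N \<and> N \<subseteq> M \<longrightarrow> N = {0} \<or> N = M)"

text \<open>The sum of all minimal left ideals, which is \<open>{0}\<close> if there are none. In a semiprime
  algebra, hence in a primitive one, it coincides with the sum of all minimal right ideals.\<close>

definition socle :: "'a::ring_1 set" where
  "socle = left_ideal hull (\<Union>{M. minimal_left_ideal M})"

definition minimal_idempotent :: "'a::complex_normed_algebra_1 \<Rightarrow> bool" where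
  "minimal_idempotent p \<longleftrightarrow> p \<noteq> 0 \<and> p * p = p \<and> range (\<lambda>x. p * x * p) = range (\<lambda>c. c *\<^sub>C p)"

lemma left_ideal_socle: "left_ideal (socle :: 'a::ring_1 set)"
  unfolding socle_def by (rule hull_in) (auto simp: left_ideal_def)

lemma minimal_left_ideal_subset_socle: "minimal_left_ideal M \<Longrightarrow> M \<subseteq> socle"
  unfolding socle_def by (meson Sup_upper hull_subset mem_Collect_eq order_trans)

lemma left_ideal_image_mult_right:
  assumes "left_ideal M" shows "left_ideal ((\<lambda>x. x * r) ` M)"
  unfolding left_ideal_def
proof (intro conjI ballI allI)
  show "0 \<in> (\<lambda>x. x * r) ` M"
    using assms by (force simp: left_ideal_def)
next
  fix x y assume "x \<in> (\<lambda>x. x * r) ` M" "y \<in> (\<lambda>x. x * r) ` M"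
  then obtain u v where "u \<in> M" "v \<in> M" "x = u * r" "y = v * r" by blast
  moreover from this have "u + v \<in> M" using assms by (simp add: left_ideal_def)
  ultimately show "x + y \<in> (\<lambda>x. x * r) ` M"
    by (metis distrib_right imageI)
next
  fix s x assume "x \<in> (\<lambda>x. x * r) ` M"
  then obtain u where "u \<in> M" "x = u * r" by blast
  moreover from this have "s * u \<in> M" using assms by (simp add: left_ideal_def)
  ultimately show "s * x \<in> (\<lambda>x. x * r) ` M"
    by (metis mult.assoc imageI)
qed

lemma minimal_left_ideal_image_mult_right:
  assumes M: "minimal_left_ideal M" and nz: "(\<lambda>x. x * r) ` M \<noteq> {0}"
  shows "minimal_left_ideal ((\<lambda>x. x * r) ` M)"
  unfolding minimal_left_ideal_def
proof (intro conjI allI impI)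
  have lM: "left_ideal M" using M by (simp add: minimal_left_ideal_def)
  then show "left_ideal ((\<lambda>x. x * r) ` M)" by (rule left_ideal_image_mult_right)
  show "(\<lambda>x. x * r) ` M \<noteq> {0}" by (rule nz)
  fix N assume N: "left_ideal N \<and> N \<subseteq> (\<lambda>x. x * r) ` M"
  let ?K = "{x \<in> M. x * r \<in> N}"
  have "left_ideal ?K"
    using lM N by (auto simp: left_ideal_def distrib_right mult.assoc)
  then have "?K = {0} \<or> ?K = M"
    using M unfolding minimal_left_ideal_def by blast
  moreover have "N = (\<lambda>x. x * r) ` ?K" using N by blast
  ultimately show "N = {0} \<or> N = (\<lambda>x. x * r) ` M" by auto
qed

lemma socle_mult_right:
  assumes "x \<in> (socle :: 'a::ring_1 set)" shows "x * r \<in> socle"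
proof -
  let ?S = "{x :: 'a. x * r \<in> socle}"
  have "left_ideal ?S"
    using left_ideal_socle by (auto simp: left_ideal_def distrib_right mult.assoc)
  moreover have "M \<subseteq> ?S" if "minimal_left_ideal M" for M
  proof (cases "(\<lambda>x. x * r) ` M = {0}")
    case True
    then have "x * r = 0" if "x \<in> M" for x using that by blast
    then show ?thesis using left_ideal_socle by (auto simp: left_ideal_def)
  next
    case False
    then show ?thesis
      using minimal_left_ideal_subset_socle[OF minimal_left_ideal_image_mult_right[OF that]] by blast
  qed
  ultimately have "socle \<subseteq> ?S"
    unfolding socle_def by (intro hull_minimal) auto
  then show ?thesis using assms by blast
qed

text \<open>So \<open>ring_of_type_algebra Quot socle\<close> is indeed a ring.\<close>

lemma ideal_socle: "ideal (socle :: 'a::ring_1 set) ring_of_type_algebra"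
proof (rule idealI)
  show "Ring.ring (ring_of_type_algebra :: 'a ring)"
    unfolding ring_of_type_algebra_def
    by unfold_locales (auto simp: algebra_simps Units_def intro: exI[of _ "- _"])
  then interpret R: Ring.ring "ring_of_type_algebra :: 'a ring" .
  have minus: "- x \<in> socle" if "x \<in> socle" for x :: 'a
    using that left_ideal_socle unfolding left_ideal_def by (metis mult_minus1)
  show "subgroup (socle :: 'a set) (add_monoid ring_of_type_algebra)"
  proof (rule R.add.subgroupI)
    fix x :: 'a assume x: "x \<in> socle"
    have "\<ominus>\<^bsub>ring_of_type_algebra\<^esub> x = - x"
      by (rule R.minus_equality) (simp_all add: ring_of_type_algebra_def)
    then show "\<ominus>\<^bsub>ring_of_type_algebra\<^esub> x \<in> socle"
      using minus[OF x] by simp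
  qed (use left_ideal_socle in \<open>auto simp: left_ideal_def ring_of_type_algebra_def\<close>)
qed (use left_ideal_socle socle_mult_right in \<open>auto simp: left_ideal_def ring_of_type_algebra_def\<close>)


section \<open>B-Fredholm elements\<close>

definition Drazin_invertible :: "('a, 'b) ring_scheme \<Rightarrow> 'a \<Rightarrow> bool" where
  "Drazin_invertible R x \<longleftrightarrow> x \<in> carrier R \<and> (\<exists>y\<in>carrier R. \<exists>k::nat.
     y \<otimes>\<^bsub>R\<^esub> x \<otimes>\<^bsub>R\<^esub> y = y \<and>
     x \<otimes>\<^bsub>R\<^esub> y = y \<otimes>\<^bsub>R\<^esub> x \<and>
     (x [^]\<^bsub>R\<^esub> k) \<otimes>\<^bsub>R\<^esub> y \<otimes>\<^bsub>R\<^esub> x = x [^]\<^bsub>R\<^esub> k)"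

text \<open>The coset \<open>J +> a\<close> is the image of \<open>a\<close> under the canonical projection \<open>A \<rightarrow> A / J\<close>.\<close>

definition B_Fredholm_modulo :: "'a::ring_1 set \<Rightarrow> 'a \<Rightarrow> bool" where
  "B_Fredholm_modulo J a \<longleftrightarrow>
     Drazin_invertible (ring_of_type_algebra Quot J) (J +>\<^bsub>ring_of_type_algebra\<^esub> a)"


section \<open>B-Fredholm operators\<close>

text \<open>Operators live on Banach spaces that are complete complex subspaces \<open>V\<close> of an ambient
  normed space. Only the values on \<open>V\<close> of a function \<open>T\<close> matter, and operators map \<open>V\<close> to itself.\<close>

definition banach_subspace :: "'a::complex_normed_vector set \<Rightarrow> bool" where
  "banach_subspace V \<longleftrightarrow> complex_vector.subspace V \<and> complete V"

definition bounded_operator_on :: "'a::complex_normed_vector set \<Rightarrow> ('a \<Rightarrow> 'a) \<Rightarrow> bool" where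
  "bounded_operator_on V T \<longleftrightarrow> T ` V \<subseteq> V \<and>
     (\<forall>x\<in>V. \<forall>y\<in>V. T (x + y) = T x + T y) \<and>
     (\<forall>c. \<forall>x\<in>V. T (c *\<^sub>C x) = c *\<^sub>C T x) \<and>
     (\<exists>K. \<forall>x\<in>V. norm (T x) \<le> K * norm x)"

text \<open>Finite-dimensional kernel and range of finite codimension in \<open>V\<close>, the latter expressed by
  finitely many vectors \<open>C\<close> whose classes span \<open>V / T V\<close>. The range is then automatically closed.\<close>

definition Fredholm_on :: "'a::complex_normed_vector set \<Rightarrow> ('a \<Rightarrow> 'a) \<Rightarrow> bool" where
  "Fredholm_on V T \<longleftrightarrow> banach_subspace V \<and> bounded_operator_on V T \<and>
     (\<exists>B. finite B \<and> complex_vector.span B = {x\<in>V. T x = 0}) \<and>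
     (\<exists>C. finite C \<and> complex_vector.span (T ` V \<union> C) = V)"

definition B_Fredholm_on :: "'a::complex_normed_vector set \<Rightarrow> ('a \<Rightarrow> 'a) \<Rightarrow> bool" where
  "B_Fredholm_on V T \<longleftrightarrow> banach_subspace V \<and> bounded_operator_on V T \<and>
     (\<exists>n::nat. closed ((T ^^ n) ` V) \<and> Fredholm_on ((T ^^ n) ` V) T)"

end

theory Submission
  imports Defs
begin

text \<open>Every element \<open>j\<close> of the socle acts on \<open>Ap\<close> with finite rank: if \<open>M\<close> is a minimal left
  ideal not annihilating \<open>Ap\<close>, then primeness of \<open>A\<close> gives \<open>m \<in> M\<close> and \<open>r\<close> with \<open>m r p = p\<close>, so
  \<open>r p m\<close> is an idempotent generating \<open>M\<close>, and \<open>x A p = x r (p m A p) \<subseteq> \<complex> x r p\<close> for \<open>x \<in> M\<close>.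
  A Drazin inverse \<open>b\<close> of \<open>a\<close> modulo the socle satisfies
  \<open>b a\<^sup>k\<^sup>+\<^sup>1 \<equiv> a\<^sup>k \<equiv> a\<^sup>k\<^sup>+\<^sup>1 b\<close> and \<open>a\<^sup>k b\<^sup>k a\<^sup>k \<equiv> a\<^sup>k\<close>. On \<open>a\<^sup>k A p\<close> these three congruences bound the
  kernel of \<open>a\<close>, bound its cokernel, and show that \<open>a\<^sup>k A p\<close> is closed.\<close>

section \<open>Finite-dimensional subspaces\<close>

text \<open>If \<open>b\<close> lies outside the closed subspace \<open>?W\<close>, some ball of
  radius \<open>d > 0\<close> around \<open>b\<close> misses \<open>?W\<close>, and rescaling gives
  \<open>d * cmod c \<le> norm (c *\<^sub>C b + w)\<close>. So the coefficients of \<open>b\<close>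
  along a convergent sequence are Cauchy, and completeness of the complex numbers alone suffices;
  the ambient space may be incomplete.\<close>

lemma closed_span_insert:
  fixes b :: "'a::complex_normed_vector"
  assumes cl: "closed (complex_vector.span B)"
  shows "closed (complex_vector.span (insert b B))"
proof (cases "b \<in> complex_vector.span B")
  case True
  then show ?thesis using cl by (simp add: complex_vector.span_redundant)
next
  case False
  let ?W = "complex_vector.span B"
  have "open (- ?W)" "b \<in> - ?W" using cl False by auto
  then obtain d where d: "d > 0" "ball b d \<subseteq> - ?W"
    unfolding open_contains_ball by blast
  have dW: "d * cmod c \<le> norm (c *\<^sub>C b + w)" if "w \<in> ?W" for c w
  proof (cases "c = 0")
    case False
    have "- ((1 / c) *\<^sub>C w) \<in> ?W"
      using that by (simp add: complex_vector.span_neg complex_vector.span_scale)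
    then have "- ((1 / c) *\<^sub>C w) \<notin> ball b d" using d by blast
    then have "d \<le> norm (b + (1 / c) *\<^sub>C w)" by (simp add: dist_norm)
    then have "d * cmod c \<le> norm (b + (1 / c) *\<^sub>C w) * cmod c"
      by (rule mult_right_mono) simp
    also have "\<dots> = norm (c *\<^sub>C (b + (1 / c) *\<^sub>C w))" by (simp add: norm_scaleC)
    also have "c *\<^sub>C (b + (1 / c) *\<^sub>C w) = c *\<^sub>C b + w"
      using False by (simp add: scaleC_add_right scaleC_scaleC)
    finally show ?thesis .
  qed simp
  show ?thesis unfolding closed_sequential_limits
  proof (intro allI impI)
    fix f l assume "(\<forall>n. f n \<in> complex_vector.span (insert b B)) \<and> f \<longlonglongrightarrow> l"
    then have f: "\<And>n. f n \<in> complex_vector.span (insert b B)" and fl: "f \<longlonglongrightarrow> l" by auto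
    from f have "\<forall>n. \<exists>c. f n - c *\<^sub>C b \<in> ?W"
      unfolding complex_vector.span_insert by blast
    then obtain c where c: "\<And>n. f n - c n *\<^sub>C b \<in> ?W" by metis
    have est: "d * dist (c m) (c n) \<le> dist (f m) (f n)" for m n
    proof -
      have "(f m - c m *\<^sub>C b) - (f n - c n *\<^sub>C b) \<in> ?W"
        by (rule complex_vector.span_diff[OF c c])
      from dW[OF this, of "c m - c n"] show ?thesis
        by (simp add: dist_norm complex_vector.scale_left_diff_distrib algebra_simps)
    qed
    have "Cauchy c"
      unfolding Cauchy_def
    proof (intro allI impI)
      fix e :: real assume "e > 0"
      with d have "d * e > 0" by simp
      then obtain N where N: "\<And>m n. m \<ge> N \<Longrightarrow> n \<ge> N \<Longrightarrow> dist (f m) (f n) < d * e"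
        using LIMSEQ_imp_Cauchy[OF fl] unfolding Cauchy_def by blast
      have "dist (c m) (c n) < e" if "m \<ge> N" "n \<ge> N" for m n
        using le_less_trans[OF est N[OF that]] d by simp
      then show "\<exists>M. \<forall>m\<ge>M. \<forall>n\<ge>M. dist (c m) (c n) < e" by blast
    qed
    then obtain c0 where c0: "c \<longlonglongrightarrow> c0"
      using Cauchy_convergent_iff convergent_def by blast
    have "(\<lambda>n. c n *\<^sub>C b) \<longlonglongrightarrow> c0 *\<^sub>C b"
    proof (rule LIM_zero_cancel, rule Lim_null_comparison)
      show "(\<lambda>n. cmod (c n - c0) * norm b) \<longlonglongrightarrow> 0"
        using c0 by (intro tendsto_mult_left_zero tendsto_norm_zero) (simp add: LIM_zero)
      show "\<forall>\<^sub>F n in sequentially. norm (c n *\<^sub>C b - c0 *\<^sub>C b) \<le> cmod (c n - c0) * norm b"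
        by (simp add: norm_scaleC flip: complex_vector.scale_left_diff_distrib)
    qed
    then have "(\<lambda>n. f n - c n *\<^sub>C b) \<longlonglongrightarrow> l - c0 *\<^sub>C b"
      using fl by (intro tendsto_diff)
    then have "l - c0 *\<^sub>C b \<in> ?W"
      by (rule closed_sequentially[OF cl c])
    then show "l \<in> complex_vector.span (insert b B)"
      unfolding complex_vector.span_insert by blast
  qed
qed

lemma closed_span_finite:
  fixes B :: "'a::complex_normed_vector set"
  assumes "finite B"
  shows "closed (complex_vector.span B)"
  using assms by induction (simp_all add: closed_span_insert)

text \<open>\<open>Fredholm_on\<close> asks for a finite set whose span equals the kernel, whereas
  estimates yield only an inclusion. A maximal independent subset of \<open>W\<close> does it, its
  size being bounded by that of \<open>B\<close>.\<close>

lemma subspace_of_finite_span: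
  assumes W: "complex_vector.subspace W" and B: "finite B" "W \<subseteq> complex_vector.span B"
  obtains C where "finite C" "complex_vector.span C = W"
proof -
  obtain C where C: "C \<subseteq> W" "complex_vector.independent C" "W \<subseteq> complex_vector.span C"
    using complex_vector.maximal_independent_subset by blast
  have "finite C"
    using complex_vector.independent_span_bound[OF B(1) C(2)] C(1) B(2) by blast
  moreover have "complex_vector.span C = W"
    using complex_vector.span_minimal[OF C(1) W] C(3) by blast
  ultimately show thesis by (rule that)
qed


section \<open>The socle acts on \<open>Ap\<close> with finite rank\<close>

lemma left_ideal_scaleC:
  fixes L :: "'a::complex_normed_algebra_1 set"
  assumes "left_ideal L" "x \<in> L"
  shows "c *\<^sub>C x \<in> L"
proof -
  have "c *\<^sub>C x = (c *\<^sub>C 1) * x" by (simp add: mult_scaleC_left)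
  then show ?thesis using assms by (simp add: left_ideal_def)
qed

text \<open>The simple module \<open>A / L\<close> is faithful. As \<open>n\<close> does not
  annihilate it, some \<open>n * x\<close> lies outside \<open>L\<close>, and maximality gives
  \<open>A n x + L = A\<close>. If \<open>p A n = 0\<close>, then \<open>p A\<close> would lie in
  \<open>L\<close>, forcing \<open>p = 0\<close>.\<close>

lemma primitive_imp_prime:
  fixes p n :: "'a::ring_1"
  assumes prim: "primitive_ideal ({0} :: 'a set)" and p: "p \<noteq> 0" and n: "n \<noteq> 0"
  obtains s where "p * s * n \<noteq> 0"
proof (rule ccontr)
  assume "\<not> thesis"
  then have z: "p * s * n = 0" for s using that by blast
  obtain L :: "'a set" where L: "maximal_left_ideal L" and ann: "{0} = {a. \<forall>x. a * x \<in> L}"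
    using prim unfolding primitive_ideal_def by blast
  have lL: "left_ideal L" using L by (simp add: maximal_left_ideal_def)
  then have L0: "0 \<in> L" and Ladd: "\<And>x y. x \<in> L \<Longrightarrow> y \<in> L \<Longrightarrow> x + y \<in> L"
    and Lmul: "\<And>r x. x \<in> L \<Longrightarrow> r * x \<in> L" by (auto simp: left_ideal_def)
  have "n \<notin> {a. \<forall>x. a * x \<in> L}" using ann n by blast
  then obtain x where x: "n * x \<notin> L" by blast
  let ?M = "{t * n * x + l | t l. l \<in> L}"
  have "left_ideal ?M"
    unfolding left_ideal_def
  proof (intro conjI ballI allI)
    show "0 \<in> ?M" using L0 by (auto intro!: exI[of _ 0])
  next
    fix u v assume "u \<in> ?M" "v \<in> ?M"
    then obtain t l t' l' where "u = t * n * x + l" "v = t' * n * x + l'" "l \<in> L" "l' \<in> L" by blast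
    then have "u + v = (t + t') * n * x + (l + l')" "l + l' \<in> L"
      by (auto simp: algebra_simps Ladd)
    then show "u + v \<in> ?M" by blast
  next
    fix r u assume "u \<in> ?M"
    then obtain t l where "u = t * n * x + l" "l \<in> L" by blast
    then have "r * u = (r * t) * n * x + r * l" "r * l \<in> L"
      by (auto simp: algebra_simps Lmul)
    then show "r * u \<in> ?M" by blast
  qed
  moreover have "L \<subseteq> ?M"
  proof
    fix l assume "l \<in> L"
    moreover have "l = 0 * n * x + l" by simp
    ultimately show "l \<in> ?M" by blast
  qed
  moreover have "n * x \<in> ?M"
    using L0 by (intro CollectI exI[of _ 1] exI[of _ 0]) simp
  ultimately have "?M = UNIV"
    using L x unfolding maximal_left_ideal_def by blast
  have "p * u \<in> L" for u
  proof -
    have "u \<in> ?M" using \<open>?M = UNIV\<close> by blast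
    then obtain t l where "u = t * n * x + l" "l \<in> L" by blast
    then have "p * u = p * t * n * x + p * l" "p * l \<in> L"
      by (auto simp: algebra_simps Lmul)
    then show ?thesis by (simp add: z)
  qed
  then have "p \<in> {0}" unfolding ann by blast
  then show False using p by simp
qed

lemma minimal_idempotent_compress:
  assumes "minimal_idempotent p"
  obtains c where "p * x * p = c *\<^sub>C p"
  using assms unfolding minimal_idempotent_def by blast

lemma minimal_left_ideal_finite_rank:
  fixes p x :: "'a::complex_normed_algebra_1"
  assumes prim: "primitive_ideal ({0} :: 'a set)" and p: "minimal_idempotent p"
    and M: "minimal_left_ideal M" and x: "x \<in> M"
  shows "\<exists>B. finite B \<and> (\<forall>y. x * y * p \<in> complex_vector.span B)"
proof (cases "\<forall>y. x * y * p = 0")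
  case True
  then show ?thesis by (intro exI[of _ "{}"]) simp
next
  case False
  then obtain r where r: "x * r * p \<noteq> 0" by blast
  have p0: "p \<noteq> 0" and pp: "p * p = p" using p by (auto simp: minimal_idempotent_def)
  have lM: "left_ideal M" using M by (simp add: minimal_left_ideal_def)
  obtain s where s: "p * s * (x * r * p) \<noteq> 0"
    using primitive_imp_prime[OF prim p0 r] by blast
  obtain c where c: "p * (s * x * r) * p = c *\<^sub>C p"
    using minimal_idempotent_compress[OF p] by blast
  have c0: "c \<noteq> 0" using s c by (auto simp: mult.assoc)
  \<comment> \<open>The factor \<open>1 / c\<close> normalises \<open>p s x\<close> so that
    \<open>m r p = p\<close>; this makes \<open>r p m\<close> an idempotent.\<close>
  define m where "m = (1 / c) *\<^sub>C (p * s * x)"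
  have mM: "m \<in> M"
    unfolding m_def using lM x by (intro left_ideal_scaleC) (simp_all add: left_ideal_def)
  have mrp: "m * r * p = p"
  proof -
    have "m * r * p = (1 / c) *\<^sub>C (p * (s * x * r) * p)"
      by (simp add: m_def mult_scaleC_left mult.assoc)
    then show ?thesis using c0 by (simp add: c scaleC_scaleC)
  qed
  define q where "q = r * p * m"
  have qq: "q * q = q"
  proof -
    have "q * q = r * p * (m * r * p) * m" by (simp add: q_def mult.assoc)
    also have "\<dots> = q" by (simp only: mrp) (simp add: q_def mult.assoc pp flip: mult.assoc[of p p])
    finally show ?thesis .
  qed
  have qM: "q \<in> M" using lM mM by (simp add: q_def left_ideal_def)
  \<comment> \<open>Multiplying \<open>q\<close> by \<open>m\<close> on the left and by
    \<open>r p\<close> on the right gives back \<open>p\<close>.\<close>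
  have "q \<noteq> 0"
  proof
    assume "q = 0"
    then have "m * (r * p * m) * r * p = 0" by (simp add: q_def)
    then have "(m * r * p) * (m * r * p) = 0" by (simp add: mult.assoc)
    then show False using mrp pp p0 by simp
  qed
  \<comment> \<open>By minimality \<open>M = A q\<close>, so right multiplication by the idempotent
    \<open>q\<close> fixes every element of \<open>M\<close>, in particular
    \<open>x\<close>.\<close>
  have "left_ideal (range (\<lambda>t. t * q))"
    by (rule left_ideal_image_mult_right) (simp add: left_ideal_def)
  moreover have "range (\<lambda>t. t * q) \<subseteq> M" using lM qM by (auto simp: left_ideal_def)
  moreover have "q \<in> range (\<lambda>t. t * q)" by (metis qq rangeI)
  ultimately have "range (\<lambda>t. t * q) = M"
    using M \<open>q \<noteq> 0\<close> unfolding minimal_left_ideal_def by blast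
  then obtain t where "x = t * q" using x by blast
  then have xq: "x = x * q" using qq by (simp add: mult.assoc)
  have "x * y * p \<in> complex_vector.span {x * r * p}" for y
  proof -
    obtain e where e: "p * (m * y) * p = e *\<^sub>C p"
      using minimal_idempotent_compress[OF p] by blast
    have "x * y * p = x * r * (p * (m * y) * p)"
      by (subst xq) (simp add: q_def mult.assoc)
    also have "\<dots> = e *\<^sub>C (x * r * p)" by (simp add: e mult_scaleC_right)
    finally show ?thesis by (simp add: complex_vector.span_scale complex_vector.span_base)
  qed
  then show ?thesis by blast
qed

text \<open>The socle is a hull, so it suffices that the elements acting on \<open>Ap\<close> with
  finite rank form a left ideal containing every minimal left ideal.\<close>

lemma socle_finite_rank:
  fixes p j :: "'a::complex_normed_algebra_1"
  assumes prim: "primitive_ideal ({0} :: 'a set)" and p: "minimal_idempotent p"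
    and j: "j \<in> socle"
  obtains B where "finite B" "\<And>y. j * y * p \<in> complex_vector.span B"
proof -
  let ?F = "{j. \<exists>B. finite B \<and> (\<forall>y. j * y * p \<in> complex_vector.span B)}"
  have "left_ideal ?F"
    unfolding left_ideal_def
  proof (intro conjI ballI allI)
    show "0 \<in> ?F" by (auto intro: exI[of _ "{}"])
  next
    fix u v assume "u \<in> ?F" "v \<in> ?F"
    then obtain B C where BC: "finite B" "\<And>y. u * y * p \<in> complex_vector.span B"
      "finite C" "\<And>y. v * y * p \<in> complex_vector.span C" by blast
    have "(u + v) * y * p \<in> complex_vector.span (B \<union> C)" for y
      using BC(2,4)[of y] complex_vector.span_mono[of B "B \<union> C"]
        complex_vector.span_mono[of C "B \<union> C"]
      by (auto simp: distrib_right intro!: complex_vector.span_add)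
    then show "u + v \<in> ?F" using BC by (auto intro!: exI[of _ "B \<union> C"])
  next
    fix r u assume "u \<in> ?F"
    then obtain B where B: "finite B" "\<And>y. u * y * p \<in> complex_vector.span B" by blast
    \<comment> \<open>Left multiplication by \<open>r\<close> is linear, so it maps the span of
      \<open>B\<close> into the span of the image of \<open>B\<close>.\<close>
    let ?S = "{z. r * z \<in> complex_vector.span ((\<lambda>z. r * z) ` B)}"
    have "complex_vector.subspace ?S"
      unfolding complex_vector.subspace_def
      by (simp add: distrib_left mult_scaleC_right complex_vector.span_zero
          complex_vector.span_add complex_vector.span_scale)
    then have "complex_vector.span B \<subseteq> ?S"
      by (intro complex_vector.span_minimal) (auto intro: complex_vector.span_base)
    then have "r * u * y * p \<in> complex_vector.span ((\<lambda>z. r * z) ` B)" for y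
      using B(2)[of y] by (auto simp: mult.assoc)
    then show "r * u \<in> ?F" using B(1) by (auto intro!: exI[of _ "(\<lambda>z. r * z) ` B"])
  qed
  moreover have "\<Union>{M. minimal_left_ideal M} \<subseteq> ?F"
    using minimal_left_ideal_finite_rank[OF prim p] by blast
  ultimately have "socle \<subseteq> ?F"
    unfolding socle_def by (intro hull_minimal)
  then show thesis using j that by blast
qed

lemma subspace_range_mult:
  fixes g p :: "'a::complex_normed_algebra_1"
  shows "complex_vector.subspace (range (\<lambda>x. g * x * p))"
  unfolding complex_vector.subspace_def
proof (intro conjI ballI allI)
  show "0 \<in> range (\<lambda>x. g * x * p)" by (auto intro: range_eqI[of _ _ 0])
next
  fix u v assume "u \<in> range (\<lambda>x. g * x * p)" "v \<in> range (\<lambda>x. g * x * p)"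
  then obtain x y where "u = g * x * p" "v = g * y * p" by blast
  then show "u + v \<in> range (\<lambda>x. g * x * p)"
    by (intro range_eqI[of _ _ "x + y"]) (simp add: algebra_simps)
next
  fix c u assume "u \<in> range (\<lambda>x. g * x * p)"
  then obtain x where "u = g * x * p" by blast
  then show "c *\<^sub>C u \<in> range (\<lambda>x. g * x * p)"
    by (intro range_eqI[of _ _ "c *\<^sub>C x"]) (simp add: mult_scaleC_left mult_scaleC_right)
qed

text \<open>Having the exact range \<open>jAp\<close> as a finite span makes \<open>jAp\<close>
  itself closed, and lets its spanning vectors be placed inside any subspace that contains
  \<open>jAp\<close>.\<close>

lemma socle_range_finite_span:
  fixes p j :: "'a::complex_normed_algebra_1"
  assumes "primitive_ideal ({0} :: 'a set)" and "minimal_idempotent p" and "j \<in> socle"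
  obtains C where "finite C" "complex_vector.span C = range (\<lambda>y. j * y * p)"
proof -
  obtain B where B: "finite B" "\<And>y. j * y * p \<in> complex_vector.span B"
    using socle_finite_rank[OF assms] by blast
  then have "range (\<lambda>y. j * y * p) \<subseteq> complex_vector.span B" by blast
  from subspace_of_finite_span[OF subspace_range_mult B(1) this] that show thesis by blast
qed


section \<open>Drazin invertibility modulo the socle\<close>

text \<open>Passes from equations between cosets in the quotient ring to congruences modulo the
  socle in the type-class ring; \<open>b\<close> represents the Drazin inverse of the coset of
  \<open>a\<close>.\<close>

lemma B_Fredholm_modulo_socleE:
  fixes a :: "'a::ring_1"
  assumes "B_Fredholm_modulo socle a"
  obtains b k where "a * b - b * a \<in> socle" "a ^ k * b * a - a ^ k \<in> socle"
proof -
  let ?R = "ring_of_type_algebra :: 'a ring"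
  let ?Q = "?R Quot socle"
  interpret ideal "socle :: 'a set" ?R by (rule ideal_socle)
  interpret h: ring_hom_ring ?R ?Q "\<lambda>x. socle +>\<^bsub>?R\<^esub> x" by (rule rcos_ring_hom_ring)
  have [simp]: "carrier ?R = UNIV" "x \<otimes>\<^bsub>?R\<^esub> y = x * y" "x \<oplus>\<^bsub>?R\<^esub> y = x + y"
    "\<one>\<^bsub>?R\<^esub> = 1" for x y
    by (simp_all add: ring_of_type_algebra_def)
  have neg: "\<ominus>\<^bsub>?R\<^esub> x = - x" for x
    by (rule minus_equality) (simp_all add: ring_of_type_algebra_def)
  \<comment> \<open>The algebraic power appends factors on the right, the type-class power on the
    left.\<close>
  have pw: "x [^]\<^bsub>?R\<^esub> (n::nat) = x ^ n" for x n
    by (induction n) (simp_all add: power_commutes)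
  have hm: "socle +>\<^bsub>?R\<^esub> (x * y) = (socle +>\<^bsub>?R\<^esub> x) \<otimes>\<^bsub>?Q\<^esub> (socle +>\<^bsub>?R\<^esub> y)" for x y
    using h.hom_mult[of x y] by simp
  have hp: "socle +>\<^bsub>?R\<^esub> (x ^ n) = (socle +>\<^bsub>?R\<^esub> x) [^]\<^bsub>?Q\<^esub> n" for x and n :: nat
    using h.hom_nat_pow[of x n] by (simp add: pw)
  have eqD: "x - y \<in> socle" if "socle +>\<^bsub>?R\<^esub> x = socle +>\<^bsub>?R\<^esub> y" for x y
    using quotient_eq_iff_same_a_r_cos[OF ideal_socle, of x y] that
    by (simp add: a_minus_def neg)
  obtain y and k :: nat where y: "y \<in> carrier ?Q"
    "(socle +>\<^bsub>?R\<^esub> a) \<otimes>\<^bsub>?Q\<^esub> y = y \<otimes>\<^bsub>?Q\<^esub> (socle +>\<^bsub>?R\<^esub> a)"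
    "((socle +>\<^bsub>?R\<^esub> a) [^]\<^bsub>?Q\<^esub> k) \<otimes>\<^bsub>?Q\<^esub> y \<otimes>\<^bsub>?Q\<^esub> (socle +>\<^bsub>?R\<^esub> a)
      = (socle +>\<^bsub>?R\<^esub> a) [^]\<^bsub>?Q\<^esub> k"
    using assms unfolding B_Fredholm_modulo_def Drazin_invertible_def by blast
  obtain b where b: "y = socle +>\<^bsub>?R\<^esub> b"
    using y(1) unfolding FactRing_def A_RCOSETS_def' by auto
  have "a * b - b * a \<in> socle"
    by (rule eqD) (use y(2) in \<open>simp add: hm b\<close>)
  moreover have "a ^ k * b * a - a ^ k \<in> socle"
    by (rule eqD) (use y(3) in \<open>simp add: hm hp b\<close>)
  ultimately show thesis by (rule that)
qed

text \<open>Modulo the socle \<open>b\<close> commutes with all powers of \<open>a\<close>, so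
  \<open>a^k b a\<close> may be rearranged at will, and the relation \<open>a^k b a = a^k\<close>
  can be iterated.\<close>

lemma B_Fredholm_modulo_socle_parametrix:
  fixes a :: "'a::ring_1"
  assumes "B_Fredholm_modulo socle a"
  obtains b k where "a ^ k - b * a ^ Suc k \<in> socle" "a ^ k - a ^ Suc k * b \<in> socle"
    "a ^ k - a ^ k * b ^ k * a ^ k \<in> socle"
proof -
  obtain b k where ab: "a * b - b * a \<in> socle" and k: "a ^ k * b * a - a ^ k \<in> socle"
    using B_Fredholm_modulo_socleE[OF assms] by blast
  have lS: "left_ideal (socle :: 'a set)" by (rule left_ideal_socle)
  have add: "x + y \<in> socle" if "x \<in> socle" "y \<in> socle" for x y :: 'a
    using lS that by (simp add: left_ideal_def)
  have left: "r * x \<in> socle" if "x \<in> socle" for x r :: 'a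
    using lS that by (simp add: left_ideal_def)
  have minus: "x - y \<in> socle" if "y - x \<in> socle" for x y :: 'a
    using left[OF that, of "-1"] by simp
  \<comment> \<open>Transitivity of congruence modulo the socle, declared so that congruences can be
    chained in calculations.\<close>
  have [trans]: "x - z \<in> socle" if "x - y \<in> socle" "y - z \<in> socle" for x y z :: 'a
    using add[OF that] by simp
  have sandwich: "r * x * s - r * y * s \<in> socle" if "x - y \<in> socle" for x y r s :: 'a
    using socle_mult_right[OF left[OF that, of r], of s] by (simp add: algebra_simps)
  have comm: "a ^ n * b - b * a ^ n \<in> socle" for n
  proof (induction n)
    case 0
    then show ?case using lS by (simp add: left_ideal_def)
  next
    case (Suc n)
    have "a ^ Suc n * b - a * b * a ^ n \<in> socle"
      using sandwich[OF Suc.IH, of a 1] by (simp add: mult.assoc)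
    also have "a * b * a ^ n - b * a ^ Suc n \<in> socle"
      using sandwich[OF ab, of 1 "a ^ n"] by (simp add: mult.assoc)
    finally show ?case .
  qed
  have 2: "a ^ Suc k * b - a ^ k \<in> socle"
  proof -
    have "a ^ Suc k * b - a ^ k * b * a \<in> socle"
      using sandwich[OF ab, of "a ^ k" 1] by (simp only: power_Suc2 mult.assoc mult_1_right)
    also note k
    finally show ?thesis .
  qed
  have "a ^ k - a ^ Suc k * b \<in> socle" by (rule minus[OF 2])
  also note comm
  finally have 1: "a ^ k - b * a ^ Suc k \<in> socle" .
  \<comment> \<open>The exponent \<open>i\<close> is freed from \<open>k\<close> for the induction;
    the case \<open>i = k\<close> is the one wanted.\<close>
  have 3: "a ^ k * b ^ i * a ^ i - a ^ k \<in> socle" for i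
  proof (induction i)
    case 0
    then show ?case using lS by (simp add: left_ideal_def)
  next
    case (Suc i)
    \<comment> \<open>The last factor \<open>b\<close> moves to the right past \<open>a^i\<close>,
      exposing the induction hypothesis.\<close>
    have "a ^ k * b ^ Suc i * a ^ Suc i - a ^ k * b ^ i * a ^ i * b * a \<in> socle"
      using sandwich[OF minus[OF comm[of i]], of "a ^ k * b ^ i" a]
      by (simp only: power_Suc2 mult.assoc)
    also have "a ^ k * b ^ i * a ^ i * b * a - a ^ k * b * a \<in> socle"
      using sandwich[OF Suc.IH, of 1 "b * a"] by (simp add: mult.assoc)
    also note k
    finally show ?case .
  qed
  show thesis using that[OF 1 minus[OF 2] minus[OF 3]] .
qed


section \<open>Left multiplication on \<open>Ap\<close>\<close>

text \<open>Put \<open>f = u - u g u\<close>. The map \<open>z - u g z\<close> sends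
  \<open>uAp\<close> into \<open>fAp\<close>, which is finite-dimensional and hence closed, so a
  limit \<open>l\<close> satisfies \<open>l - u g l \<in> fAp\<close>. Since
  \<open>f = u (1 - g u)\<close>, both \<open>fAp\<close> and \<open>u g l\<close> lie in
  \<open>uAp\<close>.\<close>

lemma closed_range_mult_minimal_idempotent:
  fixes g p u :: "'a::complex_normed_algebra_1"
  assumes prim: "primitive_ideal ({0} :: 'a set)" and p: "minimal_idempotent p"
    and g: "u - u * g * u \<in> socle"
  shows "closed (range (\<lambda>x. u * x * p))"
  unfolding closed_sequential_limits
proof (intro allI impI)
  define f where "f = u - u * g * u"
  have pp: "p * p = p" using p by (simp add: minimal_idempotent_def)
  obtain C where "finite C" "complex_vector.span C = range (\<lambda>y. f * y * p)"
    using socle_range_finite_span[OF prim p] g unfolding f_def by blast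
  then have clf: "closed (range (\<lambda>y. f * y * p))" using closed_span_finite by metis
  fix z l assume "(\<forall>n. z n \<in> range (\<lambda>x. u * x * p)) \<and> z \<longlonglongrightarrow> l"
  then have z: "\<And>n. z n \<in> range (\<lambda>x. u * x * p)" and zl: "z \<longlonglongrightarrow> l" by auto
  have "z n - u * g * z n \<in> range (\<lambda>y. f * y * p)" for n
  proof -
    obtain x where "z n = u * x * p" using z by blast
    then show ?thesis by (intro range_eqI[of _ _ x]) (simp add: f_def algebra_simps)
  qed
  moreover have "(\<lambda>n. z n - u * g * z n) \<longlonglongrightarrow> l - u * g * l"
    by (intro tendsto_intros zl)
  ultimately have "l - u * g * l \<in> range (\<lambda>y. f * y * p)"
    by (rule closed_sequentially[OF clf])
  then obtain y where y: "l - u * g * l = f * y * p" by blast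
  \<comment> \<open>Right multiplication by \<open>p\<close> fixes \<open>Ap\<close>, and this
    passes to the limit; \<open>l = l p\<close> puts \<open>u g l\<close> into
    \<open>uAp\<close>.\<close>
  have "z n * p = z n" for n
    using z[of n] pp by (auto simp: mult.assoc)
  moreover have "(\<lambda>n. z n * p) \<longlonglongrightarrow> l * p" by (intro tendsto_intros zl)
  ultimately have "z \<longlonglongrightarrow> l * p" by simp
  then have lp: "l * p = l" by (rule LIMSEQ_unique[OF _ zl])
  have "l = (l - u * g * l) + u * g * l" by simp
  also have "\<dots> = f * y * p + u * g * (l * p)" by (simp only: y lp)
  also have "\<dots> = u * (y - g * u * y + g * l) * p"
    by (simp add: f_def algebra_simps)
  finally show "l \<in> range (\<lambda>x. u * x * p)" by blast
qed

lemma bounded_operator_on_mult_left: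
  fixes a :: "'a::complex_normed_algebra_1"
  assumes "(\<lambda>y. a * y) ` V \<subseteq> V"
  shows "bounded_operator_on V (\<lambda>y. a * y)"
  using assms unfolding bounded_operator_on_def
  by (auto simp: distrib_left mult_scaleC_right intro: exI[of _ "norm a"] norm_mult_ineq)

lemma funpow_mult_left: "((\<lambda>y. a * y) ^^ n) = (\<lambda>y. a ^ n * (y::'a::monoid_mult))"
  by (induction n) (auto simp: mult.assoc)

theorem theorem3p6:
  fixes a p :: "'a::complex_banach_algebra_1"
  assumes "primitive_ideal ({0} :: 'a set)"
    and "(socle :: 'a set) \<noteq> {0}"
    and "minimal_idempotent p"
    and "B_Fredholm_modulo socle a"
  shows "B_Fredholm_on (range (\<lambda>x. x * p)) (\<lambda>y. a * y)"
proof -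
  note fin = socle_range_finite_span[OF assms(1,3)]
  obtain b k where b1: "a ^ k - b * a ^ Suc k \<in> socle" and b2: "a ^ k - a ^ Suc k * b \<in> socle"
    and b3: "a ^ k - a ^ k * b ^ k * a ^ k \<in> socle"
    using B_Fredholm_modulo_socle_parametrix[OF assms(4)] by blast
  define V where "V = range (\<lambda>x. x * p)"
  \<comment> \<open>The integer \<open>n\<close> in \<open>B_Fredholm_on\<close> is taken to be the
    Drazin exponent \<open>k\<close>, so the relevant range is \<open>a^k A p\<close>.\<close>
  define W where "W = range (\<lambda>x. a ^ k * x * p)"
  have image: "((\<lambda>y. a * y) ^^ k) ` V = W"
    by (auto simp: V_def W_def funpow_mult_left image_image mult.assoc)
  \<comment> \<open>For \<open>u = g = 1\<close> the difference \<open>u - u g u\<close> is zero, so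
    the closedness lemma also covers \<open>Ap\<close>.\<close>
  have "(0::'a) \<in> socle"
    using left_ideal_socle[where 'a='a] by (auto simp: left_ideal_def)
  then have "closed V"
    using closed_range_mult_minimal_idempotent[OF assms(1,3), of 1 1] by (simp add: V_def)
  moreover have subV: "complex_vector.subspace V"
    using subspace_range_mult[of 1 p] by (simp add: V_def)
  ultimately have V: "banach_subspace V"
    by (simp add: banach_subspace_def complete_eq_closed)
  have aV: "(\<lambda>y. a * y) ` V \<subseteq> V" by (force simp: V_def simp flip: mult.assoc)
  have clW: "closed W"
    unfolding W_def by (rule closed_range_mult_minimal_idempotent[OF assms(1,3) b3])
  have subW: "complex_vector.subspace W" unfolding W_def by (rule subspace_range_mult)
  have W: "banach_subspace W"
    using clW subW by (simp add: banach_subspace_def complete_eq_closed)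
  have aW: "(\<lambda>y. a * y) ` W \<subseteq> W"
  proof
    fix y assume "y \<in> (\<lambda>y. a * y) ` W"
    then obtain x where "y = a ^ Suc k * x * p" by (auto simp: W_def mult.assoc)
    then have "y = a ^ k * (a * x) * p" by (simp only: power_Suc2 mult.assoc)
    then show "y \<in> W" by (auto simp: W_def)
  qed
  have ker: "\<exists>B. finite B \<and> complex_vector.span B = {x \<in> W. a * x = 0}"
  proof -
    obtain B where B: "finite B"
      "complex_vector.span B = range (\<lambda>y. (a ^ k - b * a ^ Suc k) * y * p)"
      using fin[OF b1] by blast
    have sub: "{x \<in> W. a * x = 0} \<subseteq> complex_vector.span B"
    proof
      fix w assume "w \<in> {x \<in> W. a * x = 0}"
      then obtain x where x: "w = a ^ k * x * p" "a * w = 0" by (auto simp: W_def)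
      \<comment> \<open>As \<open>a w = 0\<close>, the term \<open>b a^(k+1) x p = b a w\<close>
        vanishes.\<close>
      then have "w = (a ^ k - b * a ^ Suc k) * x * p"
        by (simp add: algebra_simps)
      then show "w \<in> complex_vector.span B" unfolding B(2) by blast
    qed
    have "complex_vector.subspace {x \<in> W. a * x = 0}"
      using subW unfolding complex_vector.subspace_def
      by (simp add: distrib_left mult_scaleC_right)
    then obtain C where "finite C" "complex_vector.span C = {x \<in> W. a * x = 0}"
      by (rule subspace_of_finite_span[OF _ B(1) sub])
    then show ?thesis by blast
  qed
  have coker: "\<exists>C. finite C \<and> complex_vector.span ((\<lambda>y. a * y) ` W \<union> C) = W"
  proof -
    obtain C where C: "finite C"
      "complex_vector.span C = range (\<lambda>y. (a ^ k - a ^ Suc k * b) * y * p)"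
      using fin[OF b2] by blast
    \<comment> \<open>The span must equal \<open>W\<close>, so the correcting vectors have to lie in
      \<open>W\<close>; pulling \<open>a^k\<close> out on the left shows that they do.\<close>
    have "complex_vector.span C \<subseteq> W"
    proof
      fix w assume "w \<in> complex_vector.span C"
      then obtain y where "w = (a ^ k - a ^ Suc k * b) * y * p" unfolding C(2) by blast
      also have "\<dots> = a ^ k * ((1 - a * b) * y) * p"
        by (simp only: power_Suc2 left_diff_distrib right_diff_distrib mult.assoc mult_1_left)
      finally show "w \<in> W" unfolding W_def by blast
    qed
    then have "(\<lambda>y. a * y) ` W \<union> C \<subseteq> W"
      using aW complex_vector.span_superset[of C] by blast
    then have "complex_vector.span ((\<lambda>y. a * y) ` W \<union> C) \<subseteq> W"
      using subW by (rule complex_vector.span_minimal)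
    moreover have "W \<subseteq> complex_vector.span ((\<lambda>y. a * y) ` W \<union> C)"
    proof
      fix w assume "w \<in> W"
      then obtain x where "w = a ^ k * x * p" by (auto simp: W_def)
      \<comment> \<open>The preimage of \<open>w\<close> under \<open>a\<close>, up to finite rank,
        is \<open>a^k b x p\<close>, which again lies in \<open>W\<close>.\<close>
      then have w: "w = (a ^ k - a ^ Suc k * b) * x * p + a * (a ^ k * (b * x) * p)"
        by (simp add: algebra_simps)
      have "(a ^ k - a ^ Suc k * b) * x * p \<in> complex_vector.span C" unfolding C(2) by blast
      then have "(a ^ k - a ^ Suc k * b) * x * p \<in> complex_vector.span ((\<lambda>y. a * y) ` W \<union> C)"
        using complex_vector.span_mono[of C "(\<lambda>y. a * y) ` W \<union> C"] by blast
      moreover have "a * (a ^ k * (b * x) * p) \<in> complex_vector.span ((\<lambda>y. a * y) ` W \<union> C)"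
        by (rule complex_vector.span_base) (auto simp: W_def)
      ultimately show "w \<in> complex_vector.span ((\<lambda>y. a * y) ` W \<union> C)"
        unfolding w by (rule complex_vector.span_add)
    qed
    ultimately show ?thesis using C(1) by blast
  qed
  have "Fredholm_on W (\<lambda>y. a * y)"
    unfolding Fredholm_on_def
    using W bounded_operator_on_mult_left[OF aW] ker coker by blast
  then have "B_Fredholm_on V (\<lambda>y. a * y)"
    unfolding B_Fredholm_on_def
    using V bounded_operator_on_mult_left[OF aV] clW image
    by (intro conjI exI[of _ k]) simp_all
  then show ?thesis by (simp add: V_def)
qed

end
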